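(* Let $G$ be a split graph. Then $\operatorname{bp}(G)\geq \operatorname{mc}(G^c)-2$.
   Context: A finite simple graph $G=(V,E)$ is a split graph if $V$ can be partitioned into $V_1,V_2$ with $G(V_1)$ a clique and $V_2$ an independent set. $\operatorname{mc}(H)$ is the number of maximal cliques of $H$. A biclique $\{L,R\}$ is the complete bipartite graph with disjoint vertex sets $L,R$ and edge set $\{uv:u\in L,v\in R\}$; a biclique partition of $G$ is a collection of biclique subgraphs of $G$ such that every edge lies in exactly one of them; $\operatorname{bp}(G)$ is the minimum size of a biclique partition. *)

theory Defs
  imports "HOL-Library.Ramsey"
begin

text \<open>A graph is a pair \<open>(V, E)\<close> of a vertex set and a set of two-element edges.\<close>

type_synonym 'a ugraph = "'a set \<times> 'a set set"

definition fin_simple_graph :: "'a ugraph \<Rightarrow> bool" where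
  "fin_simple_graph G \<longleftrightarrow> finite (fst G) \<and> snd G \<subseteq> [fst G]\<^bsup>2\<^esup>"

definition compl_graph :: "'a ugraph \<Rightarrow> 'a ugraph" where
  "compl_graph G = (fst G, [fst G]\<^bsup>2\<^esup> - snd G)"

definition subgraph_of :: "'a ugraph \<Rightarrow> 'a ugraph \<Rightarrow> bool" where
  "subgraph_of H G \<longleftrightarrow> fst H \<subseteq> fst G \<and> snd H \<subseteq> snd G"

definition split_graph :: "'a ugraph \<Rightarrow> bool" where
  "split_graph G \<longleftrightarrow> fin_simple_graph G \<and>
     (\<exists>V1 V2. V1 \<union> V2 = fst G \<and> V1 \<inter> V2 = {} \<and> clique V1 (snd G) \<and> indep V2 (snd G))"

definition maximal_clique :: "'a ugraph \<Rightarrow> 'a set \<Rightarrow> bool" where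
  "maximal_clique G K \<longleftrightarrow> K \<subseteq> fst G \<and> clique K (snd G) \<and>
     (\<forall>K'. K \<subseteq> K' \<and> K' \<subseteq> fst G \<and> clique K' (snd G) \<longrightarrow> K' = K)"

definition mc :: "'a ugraph \<Rightarrow> nat" where
  "mc G = card {K. maximal_clique G K}"

definition biclique :: "'a set \<Rightarrow> 'a set \<Rightarrow> 'a ugraph" where
  "biclique L R = (L \<union> R, {{u, v} | u v. u \<in> L \<and> v \<in> R})"

definition is_biclique :: "'a ugraph \<Rightarrow> bool" where
  "is_biclique H \<longleftrightarrow> (\<exists>L R. L \<inter> R = {} \<and> H = biclique L R)"

text \<open>
  A biclique with an empty side has no edges, so allowing such bicliques, as here, does not
  affect the minimum size of a partition.
\<close>

definition biclique_partition :: "'a ugraph \<Rightarrow> 'a ugraph set \<Rightarrow> bool" where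
  "biclique_partition G P \<longleftrightarrow>
     (\<forall>B\<in>P. is_biclique B \<and> subgraph_of B G) \<and> (\<forall>e\<in>snd G. \<exists>!B. B \<in> P \<and> e \<in> snd B)"

definition bp :: "'a ugraph \<Rightarrow> nat" where
  "bp G = (LEAST k. \<exists>P. biclique_partition G P \<and> finite P \<and> card P = k)"

end

theory Submission
  imports Defs "HOL-Library.Indicator_Function" "Jordan_Normal_Form.Determinant"
begin

text \<open>
  Let \<open>V1\<close> be the clique and \<open>V2\<close> the independent set of a split partition. Maximal cliques of
  the complement are maximal independent sets, which contain at most one vertex of \<open>V1\<close>: one
  containing \<open>v \<in> V1\<close> consists of \<open>v\<close> and its non-neighbours in \<open>V2\<close>, and any other one is \<open>V2\<close>.
  So there are at most \<open>card V1 + 1\<close> of them. A biclique partition restricts to one of the complete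
  graph on \<open>V1\<close>, hence has at least \<open>card V1 - 1\<close> members by the Graham-Pollak theorem.
\<close>

lemma det_append_zero_rows:
  fixes A :: "'a::comm_ring_1 mat"
  assumes A: "A \<in> carrier_mat m n" and "m < n"
  shows "det (A @\<^sub>r 0\<^sub>m (n - m) n) = 0"
proof -
  let ?B = "A @\<^sub>r 0\<^sub>m (n - m) n"
  have B: "?B \<in> carrier_mat n n"
    using carrier_append_rows[OF A, of "0\<^sub>m (n - m) n" "n - m"] \<open>m < n\<close> by simp
  have "?B = mat\<^sub>r n n (\<lambda>i. if i = m then 0\<^sub>v n else row ?B i)"
    using assms by (intro eq_matI) (auto simp: append_rows_def)
  also have "det \<dots> = 0"
    using B \<open>m < n\<close> by (intro det_row_0) auto
  finally show ?thesis .
qed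

lemma ex_nonzero_mult_mat_vec_eq_zero:
  fixes A :: "'a::idom mat"
  assumes A: "A \<in> carrier_mat m n" and "m < n"
  obtains v where "v \<in> carrier_vec n" "v \<noteq> 0\<^sub>v n" "A *\<^sub>v v = 0\<^sub>v m"
proof -
  let ?Z = "0\<^sub>m (n - m) n :: 'a mat"
  have "A @\<^sub>r ?Z \<in> carrier_mat n n"
    using carrier_append_rows[OF A, of ?Z "n - m"] \<open>m < n\<close> by simp
  then obtain v where v: "v \<in> carrier_vec n" "v \<noteq> 0\<^sub>v n" "(A @\<^sub>r ?Z) *\<^sub>v v = 0\<^sub>v n"
    using det_append_zero_rows[OF assms] det_0_iff_vec_prod_zero by blast
  have "0\<^sub>v m @\<^sub>v 0\<^sub>v (n - m) = 0\<^sub>v n"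
    using \<open>m < n\<close> by (intro eq_vecI) auto
  also have "\<dots> = A *\<^sub>v v @\<^sub>v ?Z *\<^sub>v v"
    using mat_mult_append[OF A _ v(1), of ?Z "n - m"] v(3) by simp
  finally have "A *\<^sub>v v = 0\<^sub>v m"
    using append_vec_eq[OF zero_carrier_vec mult_mat_vec_carrier[OF A v(1)]] by metis
  with v(1,2) show thesis by (rule that)
qed

lemma homogeneous_system_nontrivial_solution:
  fixes a :: "'i \<Rightarrow> 'k \<Rightarrow> 'f::idom"
  assumes "finite I" "finite K" "card I < card K"
  obtains x where "\<exists>k\<in>K. x k \<noteq> 0" "\<And>i. i \<in> I \<Longrightarrow> (\<Sum>k\<in>K. a i k * x k) = 0"
proof -
  obtain f where f: "bij_betw f {0..<card I} I"
    using ex_bij_betw_nat_finite[OF \<open>finite I\<close>] by blast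
  obtain g where g: "bij_betw g K {0..<card K}"
    using ex_bij_betw_finite_nat[OF \<open>finite K\<close>] by blast
  define A where "A = mat (card I) (card K) (\<lambda>(i, j). a (f i) (the_inv_into K g j))"
  have "A \<in> carrier_mat (card I) (card K)"
    by (simp add: A_def)
  then obtain v where v: "v \<in> carrier_vec (card K)" "v \<noteq> 0\<^sub>v (card K)" "A *\<^sub>v v = 0\<^sub>v (card I)"
    using \<open>card I < card K\<close> by (rule ex_nonzero_mult_mat_vec_eq_zero)
  show thesis
  proof (rule that)
    have "g ` K = {0..<card K}"
      using g by (rule bij_betw_imp_surj_on)
    moreover obtain j where "j < card K" "v $ j \<noteq> 0"
      using v(1,2) by (auto simp: vec_eq_iff)
    ultimately show "\<exists>k\<in>K. v $ g k \<noteq> 0"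
      by (metis atLeast0LessThan imageE lessThan_iff)
  next
    fix i assume "i \<in> I"
    then obtain r where r: "r < card I" "f r = i"
      using bij_betw_imp_surj_on[OF f] by (metis atLeast0LessThan imageE lessThan_iff)
    have "(\<Sum>k\<in>K. a i k * v $ g k) = (\<Sum>k\<in>K. a i (the_inv_into K g (g k)) * v $ g k)"
      using g by (intro sum.cong) (auto simp: bij_betw_def the_inv_into_f_f)
    also have "\<dots> = (\<Sum>j\<in>{0..<card K}. a i (the_inv_into K g j) * v $ j)"
      by (rule sum.reindex_bij_betw[OF g])
    also have "\<dots> = (A *\<^sub>v v) $ r"
      using r v(1) by (simp add: A_def scalar_prod_def)
    finally show "(\<Sum>k\<in>K. a i k * v $ g k) = 0"
      using r(1) v(3) by simp
  qed
qed

corollary nonzero_fun_with_zero_sums: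
  assumes "finite \<S>" "finite K" "card \<S> < card K"
  obtains x :: "'k \<Rightarrow> 'f::idom" where "\<exists>k\<in>K. x k \<noteq> 0" "\<And>S. S \<in> \<S> \<Longrightarrow> sum x (K \<inter> S) = 0"
proof -
  obtain x :: "'k \<Rightarrow> 'f" where x: "\<exists>k\<in>K. x k \<noteq> 0"
      "\<And>S. S \<in> \<S> \<Longrightarrow> (\<Sum>k\<in>K. indicator S k * x k) = 0"
    using homogeneous_system_nontrivial_solution[OF assms, of indicator] by blast
  show thesis
    by (rule that[OF x(1)]) (use x(2) \<open>finite K\<close> in \<open>simp add: sum_indicator_mult\<close>)
qed

lemma doubleton_in_biclique_iff:
  "{u, v} \<in> snd (biclique L R) \<longleftrightarrow> u \<in> L \<and> v \<in> R \<or> u \<in> R \<and> v \<in> L"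
  by (auto simp: biclique_def doubleton_eq_iff)

lemma singleton_notin_is_biclique:
  assumes "is_biclique B"
  shows "{v} \<notin> snd B"
  using assms doubleton_in_biclique_iff[of v v] by (auto simp: is_biclique_def)

lemma biclique_partition_edges:
  assumes "biclique_partition G P"
  shows "snd G = (\<Union>B\<in>P. snd B)"
  using assms unfolding biclique_partition_def subgraph_of_def by blast

lemma biclique_partition_disjoint:
  assumes "biclique_partition G P"
  shows "disjoint_family_on snd P"
  using assms unfolding biclique_partition_def subgraph_of_def disjoint_family_on_def by blast

lemma biclique_partition_single_edges:
  assumes "fin_simple_graph G"
  shows "biclique_partition G ((\<lambda>e. (e, {e})) ` snd G)"
proof -
  have "is_biclique (e, {e}) \<and> subgraph_of (e, {e}) G" if "e \<in> snd G" for e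
  proof -
    have "e \<in> [fst G]\<^bsup>2\<^esup>"
      using assms that by (auto simp: fin_simple_graph_def)
    then obtain u v where e: "e = {u, v}" "u \<in> fst G" "v \<in> fst G" "u \<noteq> v"
      by (rule nsets2_E)
    have "(e, {e}) = biclique {u} {v}"
      using e(1) by (auto simp: biclique_def)
    moreover have "{u} \<inter> {v} = {}"
      using e(4) by simp
    ultimately have "is_biclique (e, {e})"
      unfolding is_biclique_def by blast
    moreover have "subgraph_of (e, {e}) G"
      using e(1-3) that by (simp add: subgraph_of_def)
    ultimately show ?thesis ..
  qed
  then show ?thesis
    by (auto simp: biclique_partition_def)
qed

lemma bp_attained:
  assumes "fin_simple_graph G"
  obtains P where "biclique_partition G P" "finite P" "card P = bp G"
proof -
  let ?sizes = "\<lambda>k. \<exists>P. biclique_partition G P \<and> finite P \<and> card P = k"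
  have "finite (snd G)"
    using assms finite_imp_finite_nsets finite_subset unfolding fin_simple_graph_def by blast
  then have "\<exists>k. ?sizes k"
    using biclique_partition_single_edges[OF assms] by blast
  then show thesis
    using that LeastI_ex[of ?sizes] unfolding bp_def by blast
qed

definition edge_form :: "'a set set \<Rightarrow> 'a set \<Rightarrow> ('a \<Rightarrow> 'b::comm_ring_1) \<Rightarrow> 'b" where
  "edge_form E K x = (\<Sum>u\<in>K. \<Sum>v\<in>K. indicator E {u, v} * (x u * x v))"

lemma edge_form_UN_disjoint:
  assumes "finite I" "disjoint_family_on E I"
  shows "edge_form (\<Union>i\<in>I. E i) K x = (\<Sum>i\<in>I. edge_form (E i) K x)"
proof -
  have "edge_form (\<Union>i\<in>I. E i) K x
    = (\<Sum>u\<in>K. \<Sum>v\<in>K. \<Sum>i\<in>I. indicator (E i) {u, v} * (x u * x v))"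
    by (simp add: edge_form_def indicator_UN_disjoint[OF assms] sum_distrib_right)
  also have "\<dots> = (\<Sum>u\<in>K. \<Sum>i\<in>I. \<Sum>v\<in>K. indicator (E i) {u, v} * (x u * x v))"
    by (intro sum.cong refl sum.swap)
  also have "\<dots> = (\<Sum>i\<in>I. edge_form (E i) K x)"
    unfolding edge_form_def by (rule sum.swap)
  finally show ?thesis .
qed

lemma edge_form_biclique:
  assumes "finite K" "L \<inter> R = {}"
  shows "edge_form (snd (biclique L R)) K x = 2 * sum x (K \<inter> L) * sum x (K \<inter> R)"
proof -
  let ?l = "\<lambda>u. indicator L u * x u" and ?r = "\<lambda>u. indicator R u * x u"
  have "indicator (snd (biclique L R)) {u, v} * (x u * x v) = ?l u * ?r v + ?r u * ?l v" for u v
    using assms(2) by (auto simp: indicator_def doubleton_in_biclique_iff)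
  then have "edge_form (snd (biclique L R)) K x = sum ?l K * sum ?r K + sum ?r K * sum ?l K"
    by (simp only: edge_form_def sum.distrib sum_product)
  then show ?thesis
    unfolding sum_indicator_mult[OF assms(1)] by (simp add: mult.commute)
qed

lemma edge_form_clique:
  assumes "finite K" "clique K E" "\<And>v. {v} \<notin> E"
  shows "edge_form E K x = (sum x K)\<^sup>2 - (\<Sum>v\<in>K. (x v)\<^sup>2)"
proof -
  have "edge_form E K x = (\<Sum>u\<in>K. \<Sum>v\<in>K. x u * x v - (if v = u then x u * x v else 0))"
    unfolding edge_form_def using assms(2,3)
    by (intro sum.cong refl) (auto simp: clique_def indicator_def)
  then show ?thesis
    using assms(1) by (simp add: sum_subtractf sum_product power2_eq_square)
qed

theorem Graham_Pollak:
  assumes P: "biclique_partition G P" "finite P" and K: "clique K (snd G)"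
  shows "card K \<le> card P + 1"
proof (rule ccontr)
  assume large: "\<not> card K \<le> card P + 1"
  then have "finite K"
    by (intro card_ge_0_finite) simp
  have "\<forall>B\<in>P. is_biclique B"
    using P(1) by (simp add: biclique_partition_def)
  then obtain L R where disjoint: "\<And>B. B \<in> P \<Longrightarrow> L B \<inter> R B = {}"
      and biclique: "\<And>B. B \<in> P \<Longrightarrow> B = biclique (L B) (R B)"
    unfolding is_biclique_def by metis
  \<comment> \<open>If \<open>x\<close> sums to zero over \<open>K\<close> and over its intersection with every \<open>L B\<close>, each biclique's
    form vanishes at \<open>x\<close>, so the form of the clique gives \<open>0 = 0\<^sup>2 - (\<Sum>v\<in>K. (x v)\<^sup>2)\<close>.\<close>
  have "card (insert K (L ` P)) < card K"
    using large card_insert_le_m1 card_image_le[OF P(2), of L] by (simp add: card_insert_if P(2))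
  then obtain x :: "'a \<Rightarrow> int" where nonzero: "\<exists>v\<in>K. x v \<noteq> 0"
      and zero_sum: "\<And>S. S \<in> insert K (L ` P) \<Longrightarrow> sum x (K \<inter> S) = 0"
    using nonzero_fun_with_zero_sums[of "insert K (L ` P)" K] \<open>finite K\<close> P(2) by auto
  have "edge_form (snd B) K x = 0" if "B \<in> P" for B
    using edge_form_biclique[OF \<open>finite K\<close> disjoint[OF that], of x] biclique[OF that]
      zero_sum[of "L B"] that by simp
  then have "edge_form (snd G) K x = 0"
    using edge_form_UN_disjoint[OF P(2) biclique_partition_disjoint[OF P(1)], of K x]
    by (simp add: biclique_partition_edges[OF P(1)])
  moreover have "{v} \<notin> snd G" for v
    using \<open>\<forall>B\<in>P. is_biclique B\<close> biclique_partition_edges[OF P(1)]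
    by (auto dest: singleton_notin_is_biclique)
  ultimately have "(\<Sum>v\<in>K. (x v)\<^sup>2) = 0"
    using edge_form_clique[OF \<open>finite K\<close> K, of x] zero_sum[of K] by simp
  with nonzero \<open>finite K\<close> show False
    by (simp add: sum_nonneg_eq_0_iff)
qed

corollary clique_card_le_bp:
  assumes "fin_simple_graph G" "clique K (snd G)"
  shows "card K \<le> bp G + 1"
  using bp_attained[OF assms(1)] Graham_Pollak[OF _ _ assms(2)] by metis

definition maximal_indep :: "'a ugraph \<Rightarrow> 'a set \<Rightarrow> bool" where
  "maximal_indep G M \<longleftrightarrow> M \<subseteq> fst G \<and> indep M (snd G) \<and>
     (\<forall>M'. M \<subseteq> M' \<and> M' \<subseteq> fst G \<and> indep M' (snd G) \<longrightarrow> M' = M)"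

lemma clique_compl_graph_iff:
  assumes "S \<subseteq> fst G"
  shows "clique S (snd (compl_graph G)) \<longleftrightarrow> indep S (snd G)"
  using assms by (auto simp: clique_def indep_def compl_graph_def)

lemma maximal_clique_compl_graph:
  "maximal_clique (compl_graph G) M \<longleftrightarrow> maximal_indep G M"
proof -
  have "fst (compl_graph G) = fst G"
    by (simp add: compl_graph_def)
  then show ?thesis
    unfolding maximal_clique_def maximal_indep_def by (metis clique_compl_graph_iff)
qed

definition insert_nonneighbours :: "'a set set \<Rightarrow> 'a \<Rightarrow> 'a set \<Rightarrow> 'a set" where
  "insert_nonneighbours E v W = insert v {w \<in> W. {v, w} \<notin> E}"

lemma indep_insert_nonneighbours:
  assumes "indep W E"
  shows "indep (insert_nonneighbours E v W) E"
  using assms by (auto simp: insert_nonneighbours_def indep_def insert_commute)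

lemma indep_subset_insert_nonneighbours:
  assumes M: "indep M E" "M \<subseteq> V \<union> W" and V: "clique V E" and v: "v \<in> M" "v \<in> V"
  shows "M \<subseteq> insert_nonneighbours E v W"
proof
  fix w assume "w \<in> M"
  show "w \<in> insert_nonneighbours E v W"
  proof (cases "w = v")
    case False
    then have nonadjacent: "{v, w} \<notin> E"
      using M(1) v(1) \<open>w \<in> M\<close> by (auto simp: indep_def)
    then have "w \<notin> V"
      using V v(2) False by (auto simp: clique_def)
    then have "w \<in> W"
      using M(2) \<open>w \<in> M\<close> by blast
    with nonadjacent show ?thesis
      by (simp add: insert_nonneighbours_def)
  qed (simp add: insert_nonneighbours_def)
qed

lemma maximal_indep_split_cases:
  assumes V: "fst G = V1 \<union> V2" "clique V1 (snd G)" "indep V2 (snd G)"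
    and M: "maximal_indep G M"
  shows "M = V2 \<or> (\<exists>v\<in>V1. M = insert_nonneighbours (snd G) v V2)"
proof (cases "M \<inter> V1 = {}")
  case True
  then have "M \<subseteq> V2"
    using M V(1) by (auto simp: maximal_indep_def)
  then have "M = V2"
    using M V(1,3) unfolding maximal_indep_def by blast
  then show ?thesis ..
next
  case False
  then obtain v where v: "v \<in> M" "v \<in> V1"
    by blast
  have "M \<subseteq> insert_nonneighbours (snd G) v V2"
    using M V(1) indep_subset_insert_nonneighbours[OF _ _ V(2) v]
    unfolding maximal_indep_def by metis
  moreover have "insert_nonneighbours (snd G) v V2 \<subseteq> fst G"
    using v(2) V(1) by (auto simp: insert_nonneighbours_def)
  ultimately have "M = insert_nonneighbours (snd G) v V2"
    using M indep_insert_nonneighbours[OF V(3)] unfolding maximal_indep_def by metis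
  with v(2) show ?thesis
    by blast
qed

lemma mc_compl_split_le:
  assumes "finite V1" "fst G = V1 \<union> V2" "clique V1 (snd G)" "indep V2 (snd G)"
  shows "mc (compl_graph G) \<le> card V1 + 1"
proof -
  let ?N = "\<lambda>v. insert_nonneighbours (snd G) v V2"
  have "{M. maximal_indep G M} \<subseteq> insert V2 (?N ` V1)"
    using maximal_indep_split_cases[OF assms(2-)] by blast
  then have "mc (compl_graph G) \<le> card (insert V2 (?N ` V1))"
    unfolding mc_def maximal_clique_compl_graph using assms(1) by (intro card_mono) auto
  also have "\<dots> \<le> card (?N ` V1) + 1"
    using assms(1) by (simp add: card_insert_if)
  also have "\<dots> \<le> card V1 + 1"
    using assms(1) by (simp add: card_image_le)
  finally show ?thesis .
qed

theorem theorem7: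
  fixes G :: "'a ugraph"
  assumes "split_graph G"
  shows "int (bp G) \<ge> int (mc (compl_graph G)) - 2"
proof -
  obtain V1 V2 where G: "fin_simple_graph G"
    and V: "fst G = V1 \<union> V2" "clique V1 (snd G)" "indep V2 (snd G)"
    using assms by (metis split_graph_def)
  have "finite V1"
    using G V(1) by (simp add: fin_simple_graph_def)
  then have "mc (compl_graph G) \<le> card V1 + 1"
    using V by (rule mc_compl_split_le)
  moreover have "card V1 \<le> bp G + 1"
    using G V(2) by (rule clique_card_le_bp)
  ultimately show ?thesis
    by linarith
qed

end
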